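(* Let $X_1,\ldots,X_n\in\mathfrak{X}$ and $z\in\mathbb{R}^n$. Then $z\in\mathcal{K}_{\mathcal{X}}$ if and only if for every $j=1,\ldots,n$ $$z^j=\sup\left\{\langle\xi,X_j\rangle+\eta:\ \langle\xi,X_k\rangle+\eta\le z^k\ \ \forall k=1,\ldots,n,\ \xi\in\mathbb{R}^d,\ \eta\in\mathbb{R}\right\}.$$ Moreover, $z\in\mathcal{K}_{\mathcal{X}}$ if and only if there exist vectors $\xi_1,\ldots,\xi_n\in\mathbb{R}^d$ such that $$\langle\xi_j,X_k-X_j\rangle\le z^k-z^j\qquad\forall k,j\in\{1,\ldots,n\}.$$
   Context: $\mathfrak{X}\subset\mathbb{R}^d$ ($d\ge1$) is a closed convex set with nonempty interior, and $\mathcal{X}=\{X_1,\ldots,X_n\}\subset\mathfrak{X}$. $\mathcal{K}_{\mathcal{X}}$ is the set of all $z=(z^1,\ldots,z^n)\in\mathbb{R}^n$ for which there is a convex function $\psi:\mathfrak{X}\to\mathbb{R}$ with $\psi(X_j)=z^j$ for all $j=1,\ldots,n$. Upper indices denote components of vectors. *)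

theory Defs
  imports "HOL-Analysis.Analysis"
begin

text \<open>
  A convex function \<open>\<psi> : S \<rightarrow> \<real>\<close> is rendered as a total function that is convex on \<open>S\<close>; its
  values off \<open>S\<close> are irrelevant. The set depends on the indexed family \<open>X\<close>, whose points
  may repeat, and not merely on its range.
\<close>

definition convex_data :: "(real ^ 'd) set \<Rightarrow> ('n::finite \<Rightarrow> real ^ 'd) \<Rightarrow> (real ^ 'n) set"
  where "convex_data S X = {z. \<exists>\<psi> :: real ^ 'd \<Rightarrow> real. convex_on S \<psi> \<and> (\<forall>j. \<psi> (X j) = z $ j)}"

end

theory Submission imports Defs
begin

text \<open>
  All three conditions on \<open>z\<close> are equivalent to a finite Jensen inequality: whenever some \<open>X\<^sub>j\<close> is a
  convex combination of the \<open>X\<^sub>k\<close>, then \<open>z\<^sub>j\<close> is at most the same combination of the \<open>z\<^sub>k\<close>. Both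
  convexity and the supremum formula give this directly. Conversely, Farkas' lemma, applied to the
  vectors \<open>X\<^sub>k - X\<^sub>j\<close>, turns it into a subgradient \<open>\<xi>\<^sub>j\<close>; this route stays finite-dimensional and so
  does not care whether \<open>X\<^sub>j\<close> lies on the boundary of \<open>S\<close>, where a convex function need not have
  subgradients. The subgradients yield the maximum of finitely many affine functions as an
  interpolating convex function, and the supremum is attained at \<open>\<xi>\<^sub>j\<close>.
\<close>

text \<open>The set on the right is itself a convex cone containing all generators, so minimality of
  the hull applies. It turns membership in the hull into explicit nonnegative coefficients.\<close>

lemma convex_cone_hull_range_insert_subset:
  fixes w :: "'n::finite \<Rightarrow> 'a::real_vector"
  shows "convex_cone hull (insert e (range w)) \<subseteq> {(\<Sum>k\<in>UNIV. l k *\<^sub>R w k) + s *\<^sub>R e | l s. (\<forall>k. 0 \<le> l k) \<and> 0 \<le> s}"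
    (is "_ \<subseteq> ?C")
proof (rule hull_minimal)
  have "w k \<in> ?C" for k
  proof -
    have "w k = (\<Sum>i\<in>UNIV. (if i = k then 1 else 0) *\<^sub>R w i) + 0 *\<^sub>R e"
      by (simp add: if_distrib[of "\<lambda>x. x *\<^sub>R _"] cong: if_cong)
    then show ?thesis
      by (intro CollectI exI[of _ "\<lambda>i. if i = k then 1 else 0"] exI[of _ 0]) auto
  qed
  moreover have "e \<in> ?C"
    by (intro CollectI exI[of _ "\<lambda>_. 0"] exI[of _ 1]) auto
  ultimately show "insert e (range w) \<subseteq> ?C"
    by blast
  have "x + y \<in> ?C" if "x \<in> ?C" "y \<in> ?C" for x y
  proof -
    from that obtain l s l' s' where "x = (\<Sum>k\<in>UNIV. l k *\<^sub>R w k) + s *\<^sub>R e" "\<forall>k. 0 \<le> l k" "0 \<le> s"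
      "y = (\<Sum>k\<in>UNIV. l' k *\<^sub>R w k) + s' *\<^sub>R e" "\<forall>k. 0 \<le> l' k" "0 \<le> s'"
      by blast
    then show ?thesis
      by (intro CollectI exI[of _ "\<lambda>k. l k + l' k"] exI[of _ "s + s'"])
        (auto simp: scaleR_add_left sum.distrib)
  qed
  moreover have "a *\<^sub>R x \<in> ?C" if "x \<in> ?C" "0 \<le> a" for x a
  proof -
    from that obtain l s where "x = (\<Sum>k\<in>UNIV. l k *\<^sub>R w k) + s *\<^sub>R e" "\<forall>k. 0 \<le> l k" "0 \<le> s"
      by blast
    with \<open>0 \<le> a\<close> show ?thesis
      by (intro CollectI exI[of _ "\<lambda>k. a * l k"] exI[of _ "a * s"])
        (auto simp: scaleR_add_right scaleR_sum_right)
  qed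
  moreover have "0 \<in> ?C"
    by (intro CollectI exI[of _ "\<lambda>_. 0"] exI[of _ 0]) auto
  ultimately show "convex_cone ?C"
    unfolding convex_cone_iff by blast
qed

text \<open>Separate \<open>(0, -1)\<close> from the cone generated by all \<open>(v k, c k)\<close>
  and \<open>(0, 1)\<close>, which is closed because it is finitely generated. The generator
  \<open>(0, 1)\<close> acts as a slack: membership of \<open>(0, -1)\<close> would give multipliers
  with \<open>(\<Sum>k\<in>UNIV. l k * c k) \<le> -1\<close>.\<close>

lemma farkas_inequalities:
  fixes v :: "'n::finite \<Rightarrow> 'a::euclidean_space" and c :: "'n \<Rightarrow> real"
  assumes "\<And>l. \<lbrakk>\<And>k. 0 \<le> l k; (\<Sum>k\<in>UNIV. l k *\<^sub>R v k) = 0\<rbrakk> \<Longrightarrow> 0 \<le> (\<Sum>k\<in>UNIV. l k * c k)"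
  shows "\<exists>\<xi>. \<forall>k. \<xi> \<bullet> v k \<le> c k"
proof -
  define w where "w k = (v k, c k)" for k
  define C where "C = convex_cone hull (insert (0 :: 'a, 1 :: real) (range w))"
  have "(0, -1) \<notin> C"
  proof
    assume "(0, -1) \<in> C"
    then obtain l s where "(0, -1) = (\<Sum>k\<in>UNIV. l k *\<^sub>R w k) + s *\<^sub>R (0, 1)" and ls: "\<forall>k. 0 \<le> l k" "0 \<le> s"
      unfolding C_def using convex_cone_hull_range_insert_subset by blast
    then have "(\<Sum>k\<in>UNIV. l k *\<^sub>R v k) = 0" "(\<Sum>k\<in>UNIV. l k * c k) + s = -1"
      by (simp_all add: w_def prod_eq_iff fst_sum snd_sum)
    with assms[of l] ls show False
      by auto
  qed
  moreover have C: "convex C" "closed C"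
    unfolding C_def by (auto intro!: convex_convex_cone_hull closed_convex_cone_hull)
  ultimately obtain a b where ab: "a \<bullet> (0, -1) < b" "\<And>x. x \<in> C \<Longrightarrow> b < a \<bullet> x"
    using separating_hyperplane_closed_point[of C "(0, -1)"] by blast
  obtain p t where a: "a = (p, t)"
    by fastforce
  \<comment> \<open>The apex gives \<open>b < 0\<close>, hence \<open>- t < b < 0\<close>: the
    hyperplane is not vertical, and dividing by \<open>t\<close> is possible.\<close>
  have "0 \<in> C"
    unfolding C_def by (rule convex_cone_hull_contains_0)
  then have "b < 0"
    using ab(2) by fastforce
  with ab(1) have "0 < t"
    by (simp add: a)
  \<comment> \<open>A point of the cone with negative value could be rescaled to have value exactly
    \<open>b\<close>, against strict separation.\<close>
  have nonneg: "0 \<le> a \<bullet> x" if "x \<in> C" for x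
  proof (rule ccontr)
    assume "\<not> 0 \<le> a \<bullet> x"
    then have neg: "a \<bullet> x < 0"
      by simp
    with \<open>b < 0\<close> have "(b / (a \<bullet> x)) *\<^sub>R x \<in> C"
      using that unfolding C_def by (intro convex_cone_hull_mul) (auto simp: divide_nonpos_neg)
    with ab(2) neg show False
      by fastforce
  qed
  have "(- (1 / t) *\<^sub>R p) \<bullet> v k \<le> c k" for k
  proof -
    have "w k \<in> C"
      unfolding C_def by (rule hull_inc) simp
    from nonneg[OF this] \<open>0 < t\<close> show ?thesis
      by (simp add: a w_def field_simps)
  qed
  then show ?thesis
    by blast
qed

text \<open>Farkas multipliers for the vectors \<open>X k - X j\<close>, divided by their total
  \<open>L\<close>, become the weights of a convex combination equal to \<open>X j\<close>. If
  \<open>L = 0\<close>, all multipliers vanish.\<close>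

lemma subgradient_of_finite_jensen:
  fixes X :: "'n::finite \<Rightarrow> 'a::euclidean_space" and z :: "'n \<Rightarrow> real"
  assumes "\<And>l. \<lbrakk>\<And>k. 0 \<le> l k; sum l UNIV = 1; (\<Sum>k\<in>UNIV. l k *\<^sub>R X k) = X j\<rbrakk>
             \<Longrightarrow> z j \<le> (\<Sum>k\<in>UNIV. l k * z k)"
  shows "\<exists>\<xi>. \<forall>k. \<xi> \<bullet> (X k - X j) \<le> z k - z j"
proof (rule farkas_inequalities)
  fix l :: "'n \<Rightarrow> real"
  assume nonneg: "\<And>k. 0 \<le> l k" and zero: "(\<Sum>k\<in>UNIV. l k *\<^sub>R (X k - X j)) = 0"
  define L where "L = sum l UNIV"
  have "0 \<le> L"
    unfolding L_def by (simp add: nonneg sum_nonneg)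
  show "0 \<le> (\<Sum>k\<in>UNIV. l k * (z k - z j))"
  proof (cases "L = 0")
    case True
    then have "l k = 0" for k
      using nonneg by (simp add: L_def sum_nonneg_eq_0_iff)
    then show ?thesis
      by simp
  next
    case False
    with \<open>0 \<le> L\<close> have "0 < L"
      by simp
    have "(\<Sum>k\<in>UNIV. l k *\<^sub>R X k) = L *\<^sub>R X j"
      using zero by (simp add: L_def scaleR_diff_right sum_subtractf scaleR_sum_left)
    then have "(\<Sum>k\<in>UNIV. (l k / L) *\<^sub>R X k) = X j"
      using \<open>0 < L\<close> scaleR_sum_right[of "inverse L" "\<lambda>k. l k *\<^sub>R X k" UNIV] by (simp add: field_simps)
    moreover have "(\<Sum>k\<in>UNIV. l k / L) = 1"
      using \<open>0 < L\<close> by (simp add: L_def flip: sum_divide_distrib)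
    ultimately have "z j \<le> (\<Sum>k\<in>UNIV. l k / L * z k)"
      using nonneg \<open>0 < L\<close> by (intro assms) auto
    also have "\<dots> = (\<Sum>k\<in>UNIV. l k * z k) / L"
      by (simp add: sum_divide_distrib)
    finally have "L * z j \<le> (\<Sum>k\<in>UNIV. l k * z k)"
      using \<open>0 < L\<close> by (simp add: field_simps)
    then show ?thesis
      by (simp add: L_def right_diff_distrib sum_subtractf sum_distrib_right)
  qed
qed

lemma convex_on_Max_affine:
  fixes a :: "'n::finite \<Rightarrow> 'a::real_inner" and b :: "'n \<Rightarrow> real"
  assumes "convex S"
  shows "convex_on S (\<lambda>x. Max (range (\<lambda>k. a k \<bullet> x + b k)))"
proof (rule convex_onI)
  fix t x y
  assume t: "0 < t" "t < (1 :: real)"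
  let ?f = "\<lambda>x k. a k \<bullet> x + b k"
  have "?f ((1 - t) *\<^sub>R x + t *\<^sub>R y) k \<le> (1 - t) * Max (range (?f x)) + t * Max (range (?f y))" for k
  proof -
    have "?f ((1 - t) *\<^sub>R x + t *\<^sub>R y) k = (1 - t) * ?f x k + t * ?f y k"
      by (simp add: inner_add_right algebra_simps)
    also have "\<dots> \<le> (1 - t) * Max (range (?f x)) + t * Max (range (?f y))"
      using t by (intro add_mono mult_left_mono Max_ge) auto
    finally show ?thesis .
  qed
  then show "Max (range (?f ((1 - t) *\<^sub>R x + t *\<^sub>R y)))
      \<le> (1 - t) * Max (range (?f x)) + t * Max (range (?f y))"
    by simp
qed (fact assms)

text \<open>Weights of total 1 let \<eta> move inside the sum. The bound is independent of \<xi> and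
  \<eta>, so it also bounds the supremum.\<close>

lemma affine_minorant_le_convex_combination:
  fixes X :: "'n::finite \<Rightarrow> 'a::real_inner" and z :: "'n \<Rightarrow> real"
  assumes "\<And>k. \<xi> \<bullet> X k + \<eta> \<le> z k" and "\<And>k. 0 \<le> l k" and "sum l UNIV = 1"
  shows "\<xi> \<bullet> (\<Sum>k\<in>UNIV. l k *\<^sub>R X k) + \<eta> \<le> (\<Sum>k\<in>UNIV. l k * z k)"
proof -
  have "\<xi> \<bullet> (\<Sum>k\<in>UNIV. l k *\<^sub>R X k) + \<eta> = (\<Sum>k\<in>UNIV. l k * (\<xi> \<bullet> X k + \<eta>))"
    using assms(3) by (simp add: inner_sum_right distrib_left sum.distrib flip: sum_distrib_right)
  also have "\<dots> \<le> (\<Sum>k\<in>UNIV. l k * z k)"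
    by (intro sum_mono mult_left_mono assms)
  finally show ?thesis .
qed

theorem lemma2p2:
  fixes S :: "(real ^ 'd) set"
    and X :: "'n::finite \<Rightarrow> real ^ 'd"
    and z :: "real ^ 'n"
  assumes "closed S" and "convex S" and "interior S \<noteq> {}"
    and "\<And>j. X j \<in> S"
  shows "(z \<in> convex_data S X \<longleftrightarrow>
            (\<forall>j. z $ j = Sup {\<xi> \<bullet> X j + \<eta> | (\<xi> :: real ^ 'd) (\<eta> :: real).
                               \<forall>k. \<xi> \<bullet> X k + \<eta> \<le> z $ k}))
       \<and> (z \<in> convex_data S X \<longleftrightarrow>
            (\<exists>\<xi> :: 'n \<Rightarrow> real ^ 'd. \<forall>k j. \<xi> j \<bullet> (X k - X j) \<le> z $ k - z $ j))"
    (is "(?data \<longleftrightarrow> (\<forall>j. _ = Sup (?A j))) \<and> (_ \<longleftrightarrow> ?subgradients)")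
proof -
  have "?subgradients" if "?data"
  proof -
    from that obtain \<psi> where \<psi>: "convex_on S \<psi>" "\<And>j. \<psi> (X j) = z $ j"
      by (auto simp: convex_data_def)
    have "\<exists>\<xi>. \<forall>k. \<xi> \<bullet> (X k - X j) \<le> z $ k - z $ j" for j
    proof (rule subgradient_of_finite_jensen)
      fix l :: "'n \<Rightarrow> real"
      assume "\<And>k. 0 \<le> l k" "sum l UNIV = 1" "(\<Sum>k\<in>UNIV. l k *\<^sub>R X k) = X j"
      then show "z $ j \<le> (\<Sum>k\<in>UNIV. l k * z $ k)"
        using convex_on_sum[of UNIV S \<psi> l X] \<psi> assms(4) by simp
    qed
    then have "\<forall>j. \<exists>\<xi>. \<forall>k. \<xi> \<bullet> (X k - X j) \<le> z $ k - z $ j"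
      by blast
    from choice[OF this] show ?thesis
      by blast
  qed
  moreover have "?subgradients" if sup: "\<forall>j. z $ j = Sup (?A j)"
  proof -
    have "\<exists>\<xi>. \<forall>k. \<xi> \<bullet> (X k - X j) \<le> z $ k - z $ j" for j
    proof (rule subgradient_of_finite_jensen)
      fix l :: "'n \<Rightarrow> real"
      assume l: "\<And>k. 0 \<le> l k" "sum l UNIV = 1" "(\<Sum>k\<in>UNIV. l k *\<^sub>R X k) = X j"
      \<comment> \<open>The constant function with value the least component of \<open>z\<close> is
        an admissible minorant; on the empty set, \<open>Sup\<close> would carry no
        information.\<close>
      have "(0 :: real ^ 'd) \<bullet> X k + Min (range (($) z)) \<le> z $ k" for k
        by simp
      then have "?A j \<noteq> {}"
        by blast
      then have "Sup (?A j) \<le> (\<Sum>k\<in>UNIV. l k * z $ k)"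
        using affine_minorant_le_convex_combination[where l = l and X = X and z = "($) z"] l
        by (intro cSup_least) auto
      then show "z $ j \<le> (\<Sum>k\<in>UNIV. l k * z $ k)"
        by (subst sup[rule_format, of j])
    qed
    then have "\<forall>j. \<exists>\<xi>. \<forall>k. \<xi> \<bullet> (X k - X j) \<le> z $ k - z $ j"
      by blast
    from choice[OF this] show ?thesis
      by blast
  qed
  moreover have "?data \<and> (\<forall>j. z $ j = Sup (?A j))" if "?subgradients"
  proof -
    from that obtain \<xi> :: "'n \<Rightarrow> real ^ 'd" where \<xi>: "\<And>k j. \<xi> j \<bullet> (X k - X j) \<le> z $ k - z $ j"
      by blast
    \<comment> \<open>This offset makes the affine function of slope \<open>\<xi> j\<close> take the
      value \<open>z $ j\<close> at \<open>X j\<close>; the subgradient inequality keeps it below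
      the data at every \<open>X k\<close>.\<close>
    define \<eta> where "\<eta> j = z $ j - \<xi> j \<bullet> X j" for j
    have le: "\<xi> j \<bullet> X k + \<eta> j \<le> z $ k" for j k
      using \<xi>[of j k] by (simp add: \<eta>_def inner_diff_right)
    have eq: "\<xi> j \<bullet> X j + \<eta> j = z $ j" for j
      by (simp add: \<eta>_def)
    have "Max (range (\<lambda>k. \<xi> k \<bullet> X j + \<eta> k)) = z $ j" for j
      using le eq by (intro Max_eqI) (auto intro: range_eqI[of _ _ j])
    with convex_on_Max_affine[OF assms(2), of \<xi> \<eta>] have ?data
      unfolding convex_data_def by blast
    \<comment> \<open>The \<open>j\<close>-th affine piece attains the supremum; the constraint at
      \<open>k = j\<close> is the upper bound.\<close>
    moreover have "z $ j = Sup (?A j)" for j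
    proof (rule cSup_eq_maximum[symmetric])
      show "z $ j \<in> ?A j"
        using le eq[of j] by (intro CollectI exI[of _ "\<xi> j"] exI[of _ "\<eta> j"]) auto
    qed blast
    ultimately show ?thesis
      by blast
  qed
  ultimately show ?thesis
    by blast
qed

end
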